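(* Let $\mathbb{F}_q$ be a finite field, $\theta$ an automorphism of $\mathbb{F}_q$, let $\Gamma=(P_1,\ldots,P_n)\in\mathbb{F}_q[X;\theta]^n$ be a $P$-independent tuple of monic skew polynomials, $P=\mathrm{lclm}(P_1,\ldots,P_n)$, and $\mathcal{L}=R_{P_1}\times\cdots\times R_{P_n}$. Then the map $$d_\Gamma:\mathcal{L}\times\mathcal{L}\to\mathbb{N},\qquad (u,v)\mapsto w_\Gamma(u-v)$$ is a distance on $\mathcal{L}$, where $w_\Gamma$ is the skew poly-weight associated to $\Gamma$.
   Context: $\mathbb{F}_q[X;\theta]$ is the skew polynomial ring: polynomials $\sum a_iX^i$ with coefficients in $\mathbb{F}_q$ written on the left, usual addition, and multiplication determined by $X\cdot a=\theta(a)X$ for $a\in\mathbb{F}_q$. It is right Euclidean: for $A$ and $B\neq 0$ there are unique $S,R$ with $A=SB+R$, $\deg R<\deg B$; write $R=A\operatorname{mod}_r B$. $\mathrm{gcrd}$ denotes the (monic) greatest common right divisor and $\mathrm{lclm}$ the (monic) least common left multiple. For a monic skew polynomial $P$, $R_P=\mathbb{F}_q[X;\theta]/\mathbb{F}_q[X;\theta]P$, identified with the set of skew polynomials of degree $<\deg P$. The tuple $\Gamma=(P_1,\ldots,P_n)$ with $P=\mathrm{lclm}(P_1,\ldots,P_n)$ is called $P$-independent if $\deg P=\sum_{i=1}^n\deg P_i$. In that case the map $\psi_\Gamma:R_P\to R_{P_1}\times\cdots\times R_{P_n}$, $f\mapsto(f\operatorname{mod}_r P_1,\ldots,f\operatorname{mod}_r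 P_n)$ is an isomorphism of left $\mathbb{F}_q[X;\theta]$-modules (skew Chinese Remainder Theorem). The skew poly-weight of $y\in\mathcal{L}$ associated to $\Gamma$ is $w_\Gamma(y)=\deg(P)-\deg\left(\mathrm{gcrd}(P,\psi_\Gamma^{-1}(y))\right)$, with $\mathrm{gcrd}(P,0)=P$. A distance is a map $d$ with values in $\mathbb{N}$ satisfying $d(u,v)=0\iff u=v$, $d(u,v)=d(v,u)$, and $d(u,v)\le d(u,w)+d(w,v)$. *)

theory Defs
  imports "HOL-Computational_Algebra.Polynomial"
begin

definition field_automorphism :: "('a::field \<Rightarrow> 'a) \<Rightarrow> bool" where
  "field_automorphism \<theta> \<longleftrightarrow> bij \<theta> \<and> \<theta> 1 = 1 \<and>
     (\<forall>x y. \<theta> (x + y) = \<theta> x + \<theta> y) \<and> (\<forall>x y. \<theta> (x * y) = \<theta> x * \<theta> y)"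

text \<open>
  A skew polynomial is represented by the sequence of its left coefficients, that is, by an element
  of type \<^typ>\<open>'a poly\<close>. Addition, subtraction, degree and leading coefficient are those of
  \<^typ>\<open>'a poly\<close>; only the product differs. It is the biadditive extension of
  \<open>(a X^i) (b X^j) = a \<theta>^i(b) X^(i+j)\<close>, the rule forced by \<open>X a = \<theta>(a) X\<close>. The product of
  the type class, \<open>(*)\<close>, is never used on skew polynomials.
\<close>

definition skew_mult :: "('a::field \<Rightarrow> 'a) \<Rightarrow> 'a poly \<Rightarrow> 'a poly \<Rightarrow> 'a poly" where
  "skew_mult \<theta> A B =
     (\<Sum>i\<le>degree A. \<Sum>j\<le>degree B. monom (coeff A i * (\<theta> ^^ i) (coeff B j)) (i + j))"

lemma skew_mult_X_const:
  assumes "field_automorphism \<theta>"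
  shows "skew_mult \<theta> (monom 1 1) [:a:] = skew_mult \<theta> [:\<theta> a:] (monom 1 1)"
proof -
  have "\<theta> 0 + \<theta> 0 = \<theta> 0 + 0"
    using assms unfolding field_automorphism_def by (metis add_0_right)
  then have "\<theta> 0 = 0" by (simp only: add_left_cancel)
  then show ?thesis
    using assms by (simp add: skew_mult_def degree_monom_eq field_automorphism_def)
qed

definition right_dvd :: "('a::field \<Rightarrow> 'a) \<Rightarrow> 'a poly \<Rightarrow> 'a poly \<Rightarrow> bool" where
  "right_dvd \<theta> D A \<longleftrightarrow> (\<exists>S. A = skew_mult \<theta> S D)"

text \<open>
  Since \<^term>\<open>degree 0 = 0\<close> here, the condition \<open>deg R < deg B\<close> with \<open>deg 0 = -\<infinity>\<close> has to
  mention \<open>R = 0\<close> separately; for constant \<open>B \<noteq> 0\<close> the only residue is \<open>0\<close>.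
\<close>

definition residues :: "'a::field poly \<Rightarrow> 'a poly set" where
  "residues B = {R. R = 0 \<or> degree R < degree B}"

definition mod_r :: "('a::field \<Rightarrow> 'a) \<Rightarrow> 'a poly \<Rightarrow> 'a poly \<Rightarrow> 'a poly" where
  "mod_r \<theta> A B = (THE R. R \<in> residues B \<and> (\<exists>S. A = skew_mult \<theta> S B + R))"

text \<open>
  In the next two definitions ``greatest'' and ``least'' refer to right divisibility. For monic
  \<open>P\<close> the definition gives \<open>gcrd P 0 = P\<close>.
\<close>

definition gcrd :: "('a::field \<Rightarrow> 'a) \<Rightarrow> 'a poly \<Rightarrow> 'a poly \<Rightarrow> 'a poly" where
  "gcrd \<theta> A B = (THE D. lead_coeff D = 1 \<and> right_dvd \<theta> D A \<and> right_dvd \<theta> D B \<and>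
     (\<forall>E. right_dvd \<theta> E A \<and> right_dvd \<theta> E B \<longrightarrow> right_dvd \<theta> E D))"

definition lclm :: "('a::field \<Rightarrow> 'a) \<Rightarrow> 'a poly list \<Rightarrow> 'a poly" where
  "lclm \<theta> \<Gamma> = (THE M. lead_coeff M = 1 \<and> (\<forall>Q\<in>set \<Gamma>. right_dvd \<theta> Q M) \<and>
     (\<forall>N. (\<forall>Q\<in>set \<Gamma>. right_dvd \<theta> Q N) \<longrightarrow> right_dvd \<theta> M N))"

definition P_independent :: "('a::field \<Rightarrow> 'a) \<Rightarrow> 'a poly list \<Rightarrow> bool" where
  "P_independent \<theta> \<Gamma> \<longleftrightarrow> degree (lclm \<theta> \<Gamma>) = (\<Sum>Q\<leftarrow>\<Gamma>. degree Q)"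

definition residue_tuples :: "'a::field poly list \<Rightarrow> 'a poly list set" where
  "residue_tuples \<Gamma> =
     {y. length y = length \<Gamma> \<and> (\<forall>i<length \<Gamma>. y ! i \<in> residues (\<Gamma> ! i))}"

definition tuple_diff :: "'a::field poly list \<Rightarrow> 'a poly list \<Rightarrow> 'a poly list" where
  "tuple_diff u v = map2 (-) u v"

definition crt_map :: "('a::field \<Rightarrow> 'a) \<Rightarrow> 'a poly list \<Rightarrow> 'a poly \<Rightarrow> 'a poly list" where
  "crt_map \<theta> \<Gamma> f = map (\<lambda>Q. mod_r \<theta> f Q) \<Gamma>"

text \<open>
  The inverse is taken on the residues modulo the least common left multiple. The subtraction
  of natural numbers does not truncate, because the gcrd is a right divisor of \<open>P \<noteq> 0\<close>.
\<close>

definition skew_poly_weight :: "('a::field \<Rightarrow> 'a) \<Rightarrow> 'a poly list \<Rightarrow> 'a poly list \<Rightarrow> nat" where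
  "skew_poly_weight \<theta> \<Gamma> y =
     (let P = lclm \<theta> \<Gamma> in
        degree P - degree (gcrd \<theta> P (inv_into (residues P) (crt_map \<theta> \<Gamma>) y)))"

definition skew_poly_dist ::
    "('a::field \<Rightarrow> 'a) \<Rightarrow> 'a poly list \<Rightarrow> 'a poly list \<Rightarrow> 'a poly list \<Rightarrow> nat" where
  "skew_poly_dist \<theta> \<Gamma> u v = skew_poly_weight \<theta> \<Gamma> (tuple_diff u v)"

definition distance_on :: "'b set \<Rightarrow> ('b \<Rightarrow> 'b \<Rightarrow> nat) \<Rightarrow> bool" where
  "distance_on S d \<longleftrightarrow>
     (\<forall>u\<in>S. \<forall>v\<in>S. d u v = 0 \<longleftrightarrow> u = v) \<and>
     (\<forall>u\<in>S. \<forall>v\<in>S. d u v = d v u) \<and>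
     (\<forall>u\<in>S. \<forall>v\<in>S. \<forall>w\<in>S. d u v \<le> d u w + d w v)"

end

theory Submission
  imports Defs "HOL-Library.Cardinality"
begin

text \<open>
  Let \<open>q\<close> be the size of the field. A left ideal \<open>R P + R f\<close> has a monic generator, the gcrd \<open>D\<close>
  of \<open>P\<close> and \<open>f\<close>, so its elements of degree below \<open>deg P\<close> are the products \<open>S D\<close> with
  \<open>deg S < deg P - deg D\<close>. Hence \<open>q ^ w\<close>, for \<open>w\<close> the weight of \<open>f\<close>, is the size of the cyclic
  submodule of \<open>R / R P\<close> generated by \<open>f\<close>. This submodule is trivial only for \<open>f = 0\<close>, it does not
  change when \<open>f\<close> is replaced by \<open>-f\<close>, and the one of \<open>g + h\<close> lies in the sum of those of \<open>g\<close>
  and \<open>h\<close>. The least common left multiple exists because the infinitely many skew polynomials have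
  only finitely many residue tuples, and the Chinese remainder map is an injection between finite
  sets whose sizes agree by \<open>P\<close>-independence.
\<close>

section \<open>Division in the skew polynomial ring\<close>

text \<open>A degree bound detached from any modulus: induction on the bound, and the quotients of
  degree below \<open>n - degree D\<close>, need it. Zero is always a member, even for
  \<open>n = 0\<close>.\<close>

definition polys_below :: "nat \<Rightarrow> 'a::zero poly set" where
  "polys_below n = {p. p = 0 \<or> degree p < n}"

lemma residues_eq_polys_below: "residues B = polys_below (degree B)"
  by (simp add: residues_def polys_below_def)

lemma zero_in_polys_below [simp]: "0 \<in> polys_below n"
  by (simp add: polys_below_def)

lemma polys_below_add:
  "p \<in> polys_below n \<Longrightarrow> r \<in> polys_below n \<Longrightarrow> p + r \<in> polys_below n"
  by (auto simp: polys_below_def intro: degree_add_less)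

lemma polys_below_minus:
  fixes p :: "'a::ab_group_add poly"
  shows "p \<in> polys_below n \<Longrightarrow> - p \<in> polys_below n"
  by (auto simp: polys_below_def)

lemma polys_below_diff:
  fixes p :: "'a::ab_group_add poly"
  shows "p \<in> polys_below n \<Longrightarrow> r \<in> polys_below n \<Longrightarrow> p - r \<in> polys_below n"
  using polys_below_add[of p n "- r"] polys_below_minus[of r n] by simp

text \<open>Equal leading terms cancel. This is the reduction step of long division, and it also
  covers \<open>n = 0\<close>, where the difference is zero.\<close>

lemma diff_in_polys_below:
  fixes p r :: "'a::ab_group_add poly"
  assumes "degree p = n" "degree r = n" "lead_coeff p = lead_coeff r"
  shows "p - r \<in> polys_below n"
proof -
  have "degree (p - r) \<le> n" using assms by (intro degree_diff_le) auto
  moreover have "p - r = 0" if "degree (p - r) = n"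
    using assms that by (metis coeff_diff leading_coeff_0_iff right_minus_eq)
  ultimately show ?thesis by (auto simp: polys_below_def)
qed

lemma polys_below_0: "polys_below 0 = {0}"
  by (auto simp: polys_below_def)

lemma polys_below_Suc:
  "polys_below (Suc n) = (\<lambda>(a, p). pCons a p) ` (UNIV \<times> polys_below n)"
proof (intro set_eqI iffI)
  fix p :: "'a poly"
  assume "p \<in> polys_below (Suc n)"
  moreover obtain a r where p: "p = pCons a r" by (cases p)
  ultimately have "r \<in> polys_below n" by (auto simp: polys_below_def split: if_splits)
  then show "p \<in> (\<lambda>(a, p). pCons a p) ` (UNIV \<times> polys_below n)"
    unfolding p by (intro image_eqI[where x = "(a, r)"]) auto
qed (auto simp: polys_below_def split: if_splits)

lemma card_polys_below:
  "finite (polys_below n :: 'a::{zero,finite} poly set) \<and>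
   card (polys_below n :: 'a poly set) = CARD('a) ^ n"
proof (induction n)
  case 0
  then show ?case by (simp add: polys_below_0)
next
  case (Suc n)
  have "inj_on (\<lambda>(a :: 'a, p). pCons a p) (UNIV \<times> polys_below n)"
    by (auto simp: inj_on_def)
  then show ?case using Suc
    by (simp add: polys_below_Suc card_image card_cartesian_product)
qed

section \<open>The skew product and its ring laws\<close>

locale skew_polynomials =
  fixes \<theta> :: "'a::field \<Rightarrow> 'a"
  assumes automorphism: "field_automorphism \<theta>"
begin

lemma theta_add: "\<theta> (x + y) = \<theta> x + \<theta> y"
  and theta_mult: "\<theta> (x * y) = \<theta> x * \<theta> y"
  using automorphism by (auto simp: field_automorphism_def)

lemma theta_0 [simp]: "\<theta> 0 = 0"
  using theta_add[of 0 0] by (metis add.right_neutral add_left_cancel)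

text \<open>Injectivity of \<theta> keeps leading coefficients nonzero under \<open>X_mult\<close>;
  this is why degrees add under the product.\<close>

lemma theta_eq_0_iff [simp]: "\<theta> x = 0 \<longleftrightarrow> x = 0"
  using automorphism theta_0 unfolding field_automorphism_def bij_def inj_def by metis

text \<open>Left multiplication by X, from X b = \<theta>(b) X. Its iterates replace the inner sum
  of \<open>skew_mult\<close>, so that the product becomes recursive in its left factor.\<close>

definition X_mult :: "'a poly \<Rightarrow> 'a poly" where
  "X_mult B = pCons 0 (map_poly \<theta> B)"

lemma X_mult_0 [simp]: "X_mult 0 = 0"
  by (simp add: X_mult_def)

lemma X_mult_add: "X_mult (A + B) = X_mult A + X_mult B"
  by (simp add: X_mult_def poly_eq_iff coeff_pCons coeff_map_poly theta_add split: nat.split)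

lemma X_mult_smult: "X_mult (smult a B) = smult (\<theta> a) (X_mult B)"
  by (simp add: X_mult_def poly_eq_iff coeff_pCons coeff_map_poly theta_mult split: nat.split)

lemma X_mult_monom: "X_mult (monom a n) = monom (\<theta> a) (Suc n)"
  by (simp add: X_mult_def map_poly_monom monom_Suc)

lemma degree_X_mult: "B \<noteq> 0 \<Longrightarrow> degree (X_mult B) = Suc (degree B)"
  by (simp add: X_mult_def degree_map_poly map_poly_eq_0_iff)

lemma X_mult_eq_0_iff [simp]: "X_mult B = 0 \<longleftrightarrow> B = 0"
  by (simp add: X_mult_def map_poly_eq_0_iff)

abbreviation times_skew (infixl "\<star>" 70) where
  "A \<star> B \<equiv> skew_mult \<theta> A B"

lemma X_mult_sum: "X_mult (sum f I) = (\<Sum>i\<in>I. X_mult (f i))"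
  by (induction I rule: infinite_finite_induct) (auto simp: X_mult_add)

lemma X_mult_power_eq_sum:
  "(X_mult ^^ i) B = (\<Sum>j\<le>degree B. monom ((\<theta> ^^ i) (coeff B j)) (i + j))"
  by (induction i) (simp_all add: poly_as_sum_of_monoms X_mult_sum X_mult_monom)

lemma smult_sum_right: "smult a (sum f I) = (\<Sum>i\<in>I. smult a (f i))" for f :: "'b \<Rightarrow> 'a poly"
  by (induction I rule: infinite_finite_induct) (auto simp: smult_add_right)

lemma skew_mult_eq_sum: "A \<star> B = (\<Sum>i\<le>degree A. smult (coeff A i) ((X_mult ^^ i) B))"
  by (simp add: skew_mult_def X_mult_power_eq_sum smult_sum_right smult_monom)

lemma skew_mult_0_left [simp]: "0 \<star> B = 0"
  by (simp add: skew_mult_eq_sum)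

text \<open>Writes the left factor as a + A X and moves X onto B. The inductions below use this
  recursion and generalise over the right factor where it turns into \<open>X_mult B\<close>. The
  case split is due to \<open>degree (pCons a A)\<close> being \<open>Suc (degree A)\<close> only
  for nonzero A.\<close>

lemma skew_mult_pCons: "pCons a A \<star> B = smult a B + A \<star> X_mult B"
proof (cases "A = 0")
  case True
  then show ?thesis by (simp add: skew_mult_eq_sum)
next
  case False
  then show ?thesis
    by (simp add: skew_mult_eq_sum sum.atMost_Suc_shift funpow_Suc_right
        del: sum.atMost_Suc funpow.simps)
qed

lemma skew_mult_1_left [simp]: "1 \<star> B = B"
  by (simp add: one_pCons skew_mult_pCons)

lemma skew_mult_add_right: "A \<star> (B + C) = A \<star> B + A \<star> C"
  by (induction A arbitrary: B C)
    (simp_all add: skew_mult_pCons X_mult_add smult_add_right)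

lemma skew_mult_add_left: "(A + B) \<star> C = A \<star> C + B \<star> C"
proof (induction A arbitrary: B C)
  case 0
  then show ?case by simp
next
  case (pCons a A)
  show ?case
    by (cases B) (simp add: skew_mult_pCons pCons.IH smult_add_left)
qed

lemma skew_mult_0_right [simp]: "A \<star> 0 = 0"
  using skew_mult_add_right[of A 0 0] by (metis add.right_neutral add_left_cancel)

lemma skew_mult_minus_right: "A \<star> (- B) = - (A \<star> B)"
  using skew_mult_add_right[of A B "- B"] by (simp add: eq_neg_iff_add_eq_0 add.commute)

lemma skew_mult_minus_left: "(- A) \<star> B = - (A \<star> B)"
  using skew_mult_add_left[of A "- A" B] by (simp add: eq_neg_iff_add_eq_0 add.commute)

lemma skew_mult_diff_left: "(A - B) \<star> C = A \<star> C - B \<star> C"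
  using skew_mult_add_left[of A "- B" C] by (simp add: skew_mult_minus_left)

lemma skew_mult_smult_left: "smult a B \<star> C = smult a (B \<star> C)"
  by (induction B arbitrary: C) (simp_all add: skew_mult_pCons smult_add_right)

text \<open>Associativity for the left factor X, the case to which \<open>skew_mult_assoc\<close>
  reduces by induction.\<close>

lemma X_mult_skew_mult: "X_mult B \<star> C = X_mult (B \<star> C)"
proof (induction B arbitrary: C)
  case 0
  then show ?case by simp
next
  case (pCons b B)
  have "X_mult (pCons b B) = pCons 0 (pCons (\<theta> b) (map_poly \<theta> B))"
    using pCons.hyps by (simp add: X_mult_def map_poly_pCons)
  then have "X_mult (pCons b B) \<star> C = smult (\<theta> b) (X_mult C) + X_mult B \<star> X_mult C"
    by (simp add: X_mult_def skew_mult_pCons)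
  then show ?case by (simp add: pCons.IH skew_mult_pCons X_mult_add X_mult_smult)
qed

lemma skew_mult_assoc: "A \<star> (B \<star> C) = A \<star> B \<star> C"
  by (induction A arbitrary: B)
    (simp_all add: skew_mult_pCons skew_mult_add_left skew_mult_smult_left
      flip: X_mult_skew_mult)

text \<open>In a B + A (X B) with A nonzero, the second summand has the strictly larger degree, so
  nothing cancels at the top.\<close>

lemma degree_skew_mult:
  "A \<noteq> 0 \<Longrightarrow> B \<noteq> 0 \<Longrightarrow> degree (A \<star> B) = degree A + degree B"
proof (induction A arbitrary: B)
  case 0
  then show ?case by simp
next
  case (pCons a A)
  show ?case
  proof (cases "A = 0")
    case True
    then show ?thesis using pCons.prems by (simp add: skew_mult_pCons)
  next
    case False
    then have "degree (A \<star> X_mult B) = degree A + Suc (degree B)"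
      using pCons.IH[of "X_mult B"] pCons.prems by (simp add: degree_X_mult)
    moreover have "degree (smult a B) \<le> degree B" by simp
    ultimately show ?thesis using False
      by (simp add: skew_mult_pCons degree_add_eq_right)
  qed
qed

lemma skew_mult_eq_0_iff [simp]: "A \<star> B = 0 \<longleftrightarrow> A = 0 \<or> B = 0"
proof (cases "A = 0 \<or> B = 0")
  case True
  then show ?thesis by auto
next
  case False
  \<comment> \<open>As \<open>degree 0 = 0\<close>, the degree of A B cannot rule out zero when both
    factors are constant. An extra factor X makes the degree positive.\<close>
  then have "degree (X_mult A \<star> B) \<noteq> 0" by (simp add: degree_skew_mult degree_X_mult)
  then show ?thesis using False by (auto simp: X_mult_skew_mult)
qed

text \<open>Truncated subtraction is right here: for \<open>n \<le> degree B\<close> the bound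
  becomes 0 and leaves only S = 0.\<close>

lemma skew_mult_in_polys_below_iff:
  assumes "B \<noteq> 0"
  shows "S \<star> B \<in> polys_below n \<longleftrightarrow> S \<in> polys_below (n - degree B)"
  using assms by (cases "S = 0") (auto simp: polys_below_def degree_skew_mult less_diff_conv)

section \<open>Right division with remainder\<close>

lemma skew_multiple_in_residues_iff:
  assumes "B \<noteq> 0"
  shows "S \<star> B \<in> residues B \<longleftrightarrow> S = 0"
  using assms by (simp add: residues_eq_polys_below skew_mult_in_polys_below_iff polys_below_0)

lemma right_division_exists:
  assumes "B \<noteq> 0"
  shows "\<exists>S R. R \<in> residues B \<and> A = S \<star> B + R"
proof -
  have "\<exists>S R. R \<in> residues B \<and> A = S \<star> B + R" if "A \<in> polys_below n" for n
    using that
  proof (induction n arbitrary: A)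
    case 0
    then show ?case
      by (intro exI[of _ 0]) (simp add: polys_below_0 residues_def)
  next
    case (Suc n)
    show ?case
    proof (cases "A \<in> residues B \<or> A \<in> polys_below n")
      case True
      then show ?thesis using Suc.IH by (metis add_0 skew_mult_0_left)
    next
      case False
      then have n: "degree A = n" "A \<noteq> 0" "degree B \<le> n"
        using Suc.prems by (auto simp: polys_below_def residues_def)
      define E where "E = monom 1 (n - degree B) \<star> B"
      have "E \<noteq> 0" "degree E = n"
        using assms n by (auto simp: E_def degree_skew_mult degree_monom_eq)
      \<comment> \<open>The leading coefficient of E is that of B twisted by a power of \<theta>,
        hence the division by \<open>lead_coeff E\<close>.\<close>
      define c where "c = lead_coeff A / lead_coeff E"
      have "c \<noteq> 0" using n(2) \<open>E \<noteq> 0\<close> by (simp add: c_def)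
      then have "A - smult c E \<in> polys_below n"
        using n \<open>E \<noteq> 0\<close> \<open>degree E = n\<close>
        by (intro diff_in_polys_below) (auto simp: c_def)
      then obtain S R where "R \<in> residues B" "A - smult c E = S \<star> B + R"
        using Suc.IH by blast
      then have "A = (smult c (monom 1 (n - degree B)) + S) \<star> B + R"
        by (simp add: skew_mult_add_left skew_mult_smult_left E_def algebra_simps)
      then show ?thesis using \<open>R \<in> residues B\<close> by blast
    qed
  qed
  from this[of "Suc (degree A)"] show ?thesis by (simp add: polys_below_def)
qed

lemma right_division_unique:
  assumes "B \<noteq> 0" "R \<in> residues B" "R' \<in> residues B" "S \<star> B + R = S' \<star> B + R'"
  shows "R = R'"
proof -
  have eq: "(S - S') \<star> B = R' - R"
    using assms(4) by (simp add: skew_mult_diff_left algebra_simps)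
  then have "(S - S') \<star> B \<in> residues B"
    using assms by (simp add: residues_eq_polys_below polys_below_diff)
  then have "S - S' = 0" using assms(1) skew_multiple_in_residues_iff by blast
  then show ?thesis using eq by simp
qed

lemma mod_r_eqI:
  assumes "B \<noteq> 0" "R \<in> residues B" "A = S \<star> B + R"
  shows "mod_r \<theta> A B = R"
  unfolding mod_r_def using assms right_division_unique by (intro the_equality) blast+

lemma mod_r_in_residues: "B \<noteq> 0 \<Longrightarrow> mod_r \<theta> A B \<in> residues B"
  using right_division_exists mod_r_eqI by metis

lemma right_division: "B \<noteq> 0 \<Longrightarrow> \<exists>S. A = S \<star> B + mod_r \<theta> A B"
  using right_division_exists mod_r_eqI by metis

lemma mod_r_diff:
  assumes "B \<noteq> 0"
  shows "mod_r \<theta> (A - A') B = mod_r \<theta> A B - mod_r \<theta> A' B"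
proof -
  obtain S S' where "A = S \<star> B + mod_r \<theta> A B" "A' = S' \<star> B + mod_r \<theta> A' B"
    using right_division[OF assms] by metis
  then have "A - A' = (S - S') \<star> B + (mod_r \<theta> A B - mod_r \<theta> A' B)"
    unfolding skew_mult_diff_left by (simp add: algebra_simps)
  then show ?thesis using assms
    by (intro mod_r_eqI)
      (auto simp: residues_eq_polys_below intro!: polys_below_diff
        mod_r_in_residues[unfolded residues_eq_polys_below])
qed

lemma mod_r_eq_0_iff: "B \<noteq> 0 \<Longrightarrow> mod_r \<theta> A B = 0 \<longleftrightarrow> right_dvd \<theta> B A"
  unfolding right_dvd_def
  by (metis add.right_neutral mod_r_eqI right_division zero_in_polys_below
      residues_eq_polys_below)

section \<open>Left ideals\<close>

lemma right_dvd_trans: "right_dvd \<theta> A B \<Longrightarrow> right_dvd \<theta> B C \<Longrightarrow> right_dvd \<theta> A C"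
  unfolding right_dvd_def using skew_mult_assoc by metis

lemma right_dvd_skew_mult: "right_dvd \<theta> D A \<Longrightarrow> right_dvd \<theta> D (S \<star> A)"
  by (meson right_dvd_def right_dvd_trans)

lemma right_dvd_add: "right_dvd \<theta> D A \<Longrightarrow> right_dvd \<theta> D B \<Longrightarrow> right_dvd \<theta> D (A + B)"
  unfolding right_dvd_def using skew_mult_add_left by metis

lemma right_dvd_diff: "right_dvd \<theta> D A \<Longrightarrow> right_dvd \<theta> D B \<Longrightarrow> right_dvd \<theta> D (A - B)"
  unfolding right_dvd_def using skew_mult_diff_left by metis

text \<open>Gives the uniqueness behind the definite descriptions of \<open>gcrd\<close> and
  \<open>lclm\<close>. The degrees force the cofactor to be constant, and monicity forces it to be
  1.\<close>

lemma monic_right_dvd_antisym: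
  assumes "lead_coeff D = 1" "lead_coeff E = 1" "right_dvd \<theta> D E" "right_dvd \<theta> E D"
  shows "D = E"
proof -
  obtain S T where ST: "E = S \<star> D" "D = T \<star> E"
    using assms(3,4) by (auto simp: right_dvd_def)
  have nz: "D \<noteq> 0" "E \<noteq> 0" using assms by auto
  then have "S \<noteq> 0" "T \<noteq> 0" using ST skew_mult_0_left by metis+
  then have "degree E = degree S + degree D" "degree D = degree T + degree E"
    using ST nz degree_skew_mult by metis+
  then have "degree S = 0" by simp
  then obtain s where "S = [:s:]" by (auto elim: degree_eq_zeroE)
  then have "E = smult s D" using ST(1) by (simp add: skew_mult_pCons)
  moreover from this have "s = 1"
    using assms(1,2) lead_coeff_smult[of s D] by (metis mult.right_neutral)
  ultimately show ?thesis by simp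
qed

definition left_ideal :: "'a poly set \<Rightarrow> bool" where
  "left_ideal I \<longleftrightarrow> (\<forall>A\<in>I. \<forall>B\<in>I. A - B \<in> I) \<and> (\<forall>A\<in>I. \<forall>S. S \<star> A \<in> I)"

text \<open>An element of least degree, made monic, generates: a nonzero remainder modulo it would
  be a smaller element of the ideal. Applied to R P + R f it yields the gcrd, applied to the common
  left multiples the lclm.\<close>

lemma left_ideal_principal:
  assumes "left_ideal I" "A \<in> I" "A \<noteq> 0"
  shows "\<exists>D\<in>I. lead_coeff D = 1 \<and> (\<forall>B\<in>I. right_dvd \<theta> D B)"
proof -
  obtain M where M: "M \<in> I" "M \<noteq> 0" and min: "\<And>B. B \<in> I \<Longrightarrow> B \<noteq> 0 \<Longrightarrow> degree M \<le> degree B"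
    using ex_has_least_nat[of "\<lambda>B. B \<in> I \<and> B \<noteq> 0" A degree] assms(2,3) by blast
  define D where "D = smult (inverse (lead_coeff M)) M"
  have "D = [:inverse (lead_coeff M):] \<star> M" by (simp add: D_def skew_mult_pCons)
  then have "D \<in> I" using assms(1) M by (simp add: left_ideal_def)
  have "degree D = degree M" "lead_coeff D = 1" using M by (simp_all add: D_def)
  then have "D \<noteq> 0" by auto
  have "right_dvd \<theta> D B" if "B \<in> I" for B
  proof -
    obtain S where "B = S \<star> D + mod_r \<theta> B D" using right_division \<open>D \<noteq> 0\<close> by blast
    then have "mod_r \<theta> B D = B - S \<star> D" by (simp add: algebra_simps)
    then have "mod_r \<theta> B D \<in> I"
      using assms(1) that \<open>D \<in> I\<close> by (simp add: left_ideal_def)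
    then have "mod_r \<theta> B D = 0"
      using min mod_r_in_residues[OF \<open>D \<noteq> 0\<close>, of B] \<open>degree D = degree M\<close>
      by (fastforce simp: residues_def)
    then show ?thesis using mod_r_eq_0_iff \<open>D \<noteq> 0\<close> by blast
  qed
  then show ?thesis using \<open>D \<in> I\<close> \<open>lead_coeff D = 1\<close> by blast
qed

lemma left_ideal_combinations: "left_ideal {A \<star> P + B \<star> f | A B. True}"
  unfolding left_ideal_def
proof (intro conjI ballI allI)
  fix x y assume "x \<in> {A \<star> P + B \<star> f | A B. True}" "y \<in> {A \<star> P + B \<star> f | A B. True}"
  then obtain A B A' B' where "x = A \<star> P + B \<star> f" "y = A' \<star> P + B' \<star> f" by blast
  then have "x - y = (A - A') \<star> P + (B - B') \<star> f" by (simp add: skew_mult_diff_left)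
  then show "x - y \<in> {A \<star> P + B \<star> f | A B. True}" by blast
next
  fix x S assume "x \<in> {A \<star> P + B \<star> f | A B. True}"
  then obtain A B where "x = A \<star> P + B \<star> f" by blast
  then have "S \<star> x = (S \<star> A) \<star> P + (S \<star> B) \<star> f"
    by (simp add: skew_mult_add_right skew_mult_assoc)
  then show "S \<star> x \<in> {A \<star> P + B \<star> f | A B. True}" by blast
qed

text \<open>The definite description is resolved by the monic generator of R P + R f. Its Bezout
  form shows that every common right divisor divides it; the form is exported because the cyclic
  submodule is computed from it.\<close>

lemma gcrd_properties:
  assumes "P \<noteq> 0"
  shows "lead_coeff (gcrd \<theta> P f) = 1"
    and "right_dvd \<theta> (gcrd \<theta> P f) P"
    and "right_dvd \<theta> (gcrd \<theta> P f) f"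
    and "\<exists>A B. gcrd \<theta> P f = A \<star> P + B \<star> f"
proof -
  let ?I = "{A \<star> P + B \<star> f | A B. True}"
  have "P = 1 \<star> P + 0 \<star> f" "f = 0 \<star> P + 1 \<star> f" by simp_all
  then have mem: "P \<in> ?I" "f \<in> ?I" by blast+
  then obtain D where D: "D \<in> ?I" "lead_coeff D = 1" "\<And>B. B \<in> ?I \<Longrightarrow> right_dvd \<theta> D B"
    using left_ideal_principal[OF left_ideal_combinations mem(1) assms] by blast
  have dvd: "right_dvd \<theta> D P" "right_dvd \<theta> D f"
    using D(3) mem by blast+
  have greatest: "right_dvd \<theta> E D" if "right_dvd \<theta> E P" "right_dvd \<theta> E f" for E
    using D(1) that by (auto intro: right_dvd_add right_dvd_skew_mult)
  have "gcrd \<theta> P f = D"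
    unfolding gcrd_def
    using D(2) dvd greatest by (intro the_equality) (auto intro: monic_right_dvd_antisym)
  then show "lead_coeff (gcrd \<theta> P f) = 1" "right_dvd \<theta> (gcrd \<theta> P f) P"
    "right_dvd \<theta> (gcrd \<theta> P f) f" "\<exists>A B. gcrd \<theta> P f = A \<star> P + B \<star> f"
    using D(1,2) dvd by simp_all
qed

section \<open>Cyclic submodules of R / R P, represented by remainders\<close>

definition cyclic_submodule :: "'a poly \<Rightarrow> 'a poly \<Rightarrow> 'a poly set" where
  "cyclic_submodule P f = range (\<lambda>S. mod_r \<theta> (S \<star> f) P)"

text \<open>A remainder of S f has the form S f - T P, so the gcrd divides it. Conversely, if D = A
  P + B f is the gcrd, then S D is congruent to (S B) f modulo P.\<close>

lemma cyclic_submodule_eq_gcrd_multiples: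
  assumes "P \<noteq> 0"
  shows "cyclic_submodule P f = {x \<in> residues P. right_dvd \<theta> (gcrd \<theta> P f) x}"
proof (intro set_eqI iffI)
  fix x assume "x \<in> cyclic_submodule P f"
  then obtain S where S: "x = mod_r \<theta> (S \<star> f) P" by (auto simp: cyclic_submodule_def)
  obtain T where "S \<star> f = T \<star> P + x" using right_division[OF assms] S by blast
  then have "x = S \<star> f - T \<star> P" by (simp add: algebra_simps)
  then have "right_dvd \<theta> (gcrd \<theta> P f) x"
    using gcrd_properties[OF assms] by (simp add: right_dvd_diff right_dvd_skew_mult)
  then show "x \<in> {x \<in> residues P. right_dvd \<theta> (gcrd \<theta> P f) x}"
    using S mod_r_in_residues[OF assms] by simp
next
  fix x assume x: "x \<in> {x \<in> residues P. right_dvd \<theta> (gcrd \<theta> P f) x}"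
  then obtain S where S: "x = S \<star> gcrd \<theta> P f" by (auto simp: right_dvd_def)
  obtain A B where "gcrd \<theta> P f = A \<star> P + B \<star> f" using gcrd_properties(4)[OF assms] by blast
  then have "(S \<star> B) \<star> f = (- (S \<star> A)) \<star> P + x"
    by (simp add: S skew_mult_add_right skew_mult_assoc skew_mult_minus_left)
  then have "mod_r \<theta> ((S \<star> B) \<star> f) P = x" using x assms mod_r_eqI by blast
  then show "x \<in> cyclic_submodule P f" by (auto simp: cyclic_submodule_def)
qed

text \<open>The sign moves to the multiplier, which ranges over the whole ring. One inclusion for
  all g suffices, as negation is an involution.\<close>

lemma cyclic_submodule_uminus: "cyclic_submodule P (- f) = cyclic_submodule P f"
proof -
  have "cyclic_submodule P (- g) \<subseteq> cyclic_submodule P g" for g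
  proof -
    have "S \<star> (- g) = (- S) \<star> g" for S
      by (simp add: skew_mult_minus_left skew_mult_minus_right)
    then show ?thesis by (auto simp: cyclic_submodule_def)
  qed
  from this[of f] this[of "- f"] show ?thesis by simp
qed

text \<open>Source of the triangle inequality: indexing by pairs bounds the size by a product, which
  makes the exponents subadditive.\<close>

lemma cyclic_submodule_diff_subset:
  assumes "P \<noteq> 0"
  shows "cyclic_submodule P (g - h)
    \<subseteq> (\<lambda>(x, y). x - y) ` (cyclic_submodule P g \<times> cyclic_submodule P h)"
proof
  fix x assume "x \<in> cyclic_submodule P (g - h)"
  then obtain S where "x = mod_r \<theta> (S \<star> (g - h)) P" by (auto simp: cyclic_submodule_def)
  moreover have "S \<star> (g - h) = S \<star> g - S \<star> h"
    using skew_mult_add_right[of S g "- h"] by (simp add: skew_mult_minus_right)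
  ultimately have "x = mod_r \<theta> (S \<star> g) P - mod_r \<theta> (S \<star> h) P"
    using mod_r_diff[OF assms] by simp
  then show "x \<in> (\<lambda>(x, y). x - y) ` (cyclic_submodule P g \<times> cyclic_submodule P h)"
    by (force simp: cyclic_submodule_def)
qed

lemma cyclic_submodule_eq_singleton_iff:
  assumes "P \<noteq> 0" "f \<in> residues P"
  shows "cyclic_submodule P f = {0} \<longleftrightarrow> f = 0"
proof
  \<comment> \<open>The multiplier 1 places f in its own submodule, because f is already
    reduced.\<close>
  have "mod_r \<theta> (1 \<star> f) P = f" using assms by (intro mod_r_eqI[where S = 0]) auto
  then have "f \<in> cyclic_submodule P f" unfolding cyclic_submodule_def by (metis rangeI)
  then show "f = 0" if "cyclic_submodule P f = {0}" using that by simp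
next
  have "mod_r \<theta> 0 P = 0" using assms
    by (intro mod_r_eqI[where S = 0]) (auto simp: residues_def)
  then show "cyclic_submodule P f = {0}" if "f = 0" using that by (auto simp: cyclic_submodule_def)
qed

end

section \<open>Skew polynomials over a finite field\<close>

lemma residue_tuples_Nil: "residue_tuples [] = {[]}"
  by (auto simp: residue_tuples_def)

lemma residue_tuples_Cons:
  "residue_tuples (Q # \<Gamma>) = (\<lambda>(x, y). x # y) ` (residues Q \<times> residue_tuples \<Gamma>)"
proof (intro set_eqI iffI)
  fix z assume "z \<in> residue_tuples (Q # \<Gamma>)"
  then show "z \<in> (\<lambda>(x, y). x # y) ` (residues Q \<times> residue_tuples \<Gamma>)"
    by (cases z) (force simp: residue_tuples_def image_iff)+
qed (auto simp: residue_tuples_def nth_Cons split: nat.split)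

lemma card_residue_tuples:
  fixes \<Gamma> :: "'a::{field,finite} poly list"
  shows "finite (residue_tuples \<Gamma>) \<and>
    card (residue_tuples \<Gamma>) = CARD('a) ^ (\<Sum>Q\<leftarrow>\<Gamma>. degree Q)"
proof (induction \<Gamma>)
  case Nil
  then show ?case by (simp add: residue_tuples_Nil)
next
  case (Cons Q \<Gamma>)
  have "inj_on (\<lambda>(x, y). x # y) (residues Q \<times> residue_tuples \<Gamma>)" by (auto simp: inj_on_def)
  then show ?case using Cons card_polys_below[where ?'a = 'a]
    by (simp add: residue_tuples_Cons card_image card_cartesian_product power_add
        residues_eq_polys_below)
qed

lemma infinite_UNIV_poly: "infinite (UNIV :: 'a::zero_neq_one poly set)"
proof
  assume "finite (UNIV :: 'a poly set)"
  then have "finite (range (monom (1 :: 'a)))" by (rule finite_subset[rotated]) simp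
  moreover have "inj (monom (1 :: 'a))" by (auto simp: inj_def monom_eq_iff')
  ultimately show False using finite_imageD infinite_UNIV_nat by blast
qed

section \<open>Sizes of cyclic submodules\<close>

locale finite_skew_polynomials = skew_polynomials \<theta>
  for \<theta> :: "'a::{field,finite} \<Rightarrow> 'a"
begin

text \<open>Right multiplication by D is a bijection from the quotients of degree below
  \<open>n - degree D\<close> onto these multiples.\<close>

lemma card_multiples_below:
  assumes "D \<noteq> 0"
  shows "card {x \<in> polys_below n. right_dvd \<theta> D x} = CARD('a) ^ (n - degree D)"
proof -
  have "{x \<in> polys_below n. right_dvd \<theta> D x} = (\<lambda>S. S \<star> D) ` polys_below (n - degree D)"
    using skew_mult_in_polys_below_iff[OF assms] by (auto simp: right_dvd_def)
  moreover have "inj (\<lambda>S. S \<star> D)"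
  proof (rule injI)
    fix S T assume "S \<star> D = T \<star> D"
    then have "(S - T) \<star> D = 0" by (simp add: skew_mult_diff_left)
    then show "S = T" using assms by simp
  qed
  ultimately show ?thesis
    using card_polys_below[where ?'a = 'a] by (simp add: card_image inj_on_subset[of _ UNIV])
qed

lemma card_cyclic_submodule:
  assumes "P \<noteq> 0"
  shows "card (cyclic_submodule P f) = CARD('a) ^ (degree P - degree (gcrd \<theta> P f))"
proof -
  have "gcrd \<theta> P f \<noteq> 0" using gcrd_properties(1)[OF assms, of f] by auto
  then show ?thesis
    by (simp add: cyclic_submodule_eq_gcrd_multiples[OF assms] residues_eq_polys_below
        card_multiples_below)
qed

lemma finite_cyclic_submodule: "P \<noteq> 0 \<Longrightarrow> finite (cyclic_submodule P f)"
  using card_polys_below[where ?'a = 'a]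
  by (simp add: cyclic_submodule_eq_gcrd_multiples residues_eq_polys_below)

text \<open>Makes powers of the field size strictly increasing, so that comparisons of sizes descend
  to their exponents.\<close>

lemma CARD_gt_1: "CARD('a) > 1"
  using card_mono[of UNIV "{0 :: 'a, 1}"] by simp

section \<open>The least common left multiple and the Chinese remainder map\<close>

context
  fixes \<Gamma> :: "'a poly list"
  assumes monic: "\<forall>Q\<in>set \<Gamma>. lead_coeff Q = 1"
begin

lemma component_nonzero: "Q \<in> set \<Gamma> \<Longrightarrow> Q \<noteq> 0"
  using monic by force

lemma crt_map_in_residue_tuples: "crt_map \<theta> \<Gamma> f \<in> residue_tuples \<Gamma>"
  using component_nonzero by (auto simp: crt_map_def residue_tuples_def mod_r_in_residues)

lemma crt_map_diff: "crt_map \<theta> \<Gamma> (f - g) = tuple_diff (crt_map \<theta> \<Gamma> f) (crt_map \<theta> \<Gamma> g)"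
  using component_nonzero
  by (auto simp: crt_map_def tuple_diff_def map2_map_map mod_r_diff)

lemma crt_map_eq_imp_right_dvd_diff:
  assumes "crt_map \<theta> \<Gamma> f = crt_map \<theta> \<Gamma> g" "Q \<in> set \<Gamma>"
  shows "right_dvd \<theta> Q (f - g)"
proof -
  have "mod_r \<theta> f Q = mod_r \<theta> g Q" using assms by (simp add: crt_map_def)
  then have "mod_r \<theta> (f - g) Q = 0"
    using mod_r_diff[OF component_nonzero[OF assms(2)]] by simp
  then show ?thesis using mod_r_eq_0_iff[OF component_nonzero[OF assms(2)]] by simp
qed

text \<open>A pigeonhole argument that supplies the nonzero member required by
  \<open>left_ideal_principal\<close>. It covers the empty tuple, where all residue tuples are
  \<open>[]\<close>.\<close>

lemma common_multiple_exists: "\<exists>M. M \<noteq> 0 \<and> (\<forall>Q\<in>set \<Gamma>. right_dvd \<theta> Q M)"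
proof -
  have "finite (range (crt_map \<theta> \<Gamma>))"
    using card_residue_tuples crt_map_in_residue_tuples by (meson finite_subset image_subsetI)
  then have "\<not> inj (crt_map \<theta> \<Gamma>)" using infinite_UNIV_poly finite_imageD by blast
  then obtain f g where "f \<noteq> g" "crt_map \<theta> \<Gamma> f = crt_map \<theta> \<Gamma> g" by (auto simp: inj_def)
  then show ?thesis using crt_map_eq_imp_right_dvd_diff
    by (intro exI[of _ "f - g"]) auto
qed

lemma
  shows lead_coeff_lclm: "lead_coeff (lclm \<theta> \<Gamma>) = 1"
    and lclm_least: "\<forall>Q\<in>set \<Gamma>. right_dvd \<theta> Q N \<Longrightarrow> right_dvd \<theta> (lclm \<theta> \<Gamma>) N"
proof -
  let ?I = "{M. \<forall>Q\<in>set \<Gamma>. right_dvd \<theta> Q M}"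
  have "left_ideal ?I" by (auto simp: left_ideal_def right_dvd_diff right_dvd_skew_mult)
  moreover obtain M where "M \<in> ?I" "M \<noteq> 0" using common_multiple_exists by auto
  ultimately obtain D
    where D: "D \<in> ?I" "lead_coeff D = 1" "\<And>B. B \<in> ?I \<Longrightarrow> right_dvd \<theta> D B"
    using left_ideal_principal[of ?I M] by blast
  have "lclm \<theta> \<Gamma> = D"
    unfolding lclm_def using D by (intro the_equality) (auto intro: monic_right_dvd_antisym)
  then show "lead_coeff (lclm \<theta> \<Gamma>) = 1"
    "\<forall>Q\<in>set \<Gamma>. right_dvd \<theta> Q N \<Longrightarrow> right_dvd \<theta> (lclm \<theta> \<Gamma>) N"
    using D by auto
qed

lemma lclm_nonzero: "lclm \<theta> \<Gamma> \<noteq> 0"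
  using lead_coeff_lclm by force

text \<open>Two reduced polynomials with equal tuples differ by a common left multiple, hence by a
  multiple of the lclm, whose degree is too large unless it is zero.\<close>

lemma inj_on_crt_map: "inj_on (crt_map \<theta> \<Gamma>) (residues (lclm \<theta> \<Gamma>))"
proof (rule inj_onI)
  fix f g
  assume fg: "f \<in> residues (lclm \<theta> \<Gamma>)" "g \<in> residues (lclm \<theta> \<Gamma>)"
    "crt_map \<theta> \<Gamma> f = crt_map \<theta> \<Gamma> g"
  then obtain S where S: "f - g = S \<star> lclm \<theta> \<Gamma>"
    using crt_map_eq_imp_right_dvd_diff lclm_least unfolding right_dvd_def[of _ "lclm \<theta> \<Gamma>"]
    by blast
  have "f - g \<in> residues (lclm \<theta> \<Gamma>)"
    using fg by (simp add: residues_eq_polys_below polys_below_diff)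
  then show "f = g" using S skew_multiple_in_residues_iff[OF lclm_nonzero] by auto
qed

theorem skew_chinese_remainder:
  assumes "P_independent \<theta> \<Gamma>"
  shows "bij_betw (crt_map \<theta> \<Gamma>) (residues (lclm \<theta> \<Gamma>)) (residue_tuples \<Gamma>)"
proof -
  have "crt_map \<theta> \<Gamma> ` residues (lclm \<theta> \<Gamma>) = residue_tuples \<Gamma>"
  proof (rule card_subset_eq)
    \<comment> \<open>P-independence equates the two exponents of the field size.\<close>
    have "card (residues (lclm \<theta> \<Gamma>)) = card (residue_tuples \<Gamma>)"
      using assms card_residue_tuples[of \<Gamma>] card_polys_below[where ?'a = 'a]
      by (simp add: residues_eq_polys_below P_independent_def)
    then show "card (crt_map \<theta> \<Gamma> ` residues (lclm \<theta> \<Gamma>)) = card (residue_tuples \<Gamma>)"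
      by (simp add: card_image[OF inj_on_crt_map])
  qed (use card_residue_tuples crt_map_in_residue_tuples in auto)
  then show ?thesis using inj_on_crt_map by (simp add: bij_betw_def)
qed

section \<open>The distance through cyclic submodules\<close>

lemma skew_poly_dist_crt_map:
  assumes "f \<in> residues (lclm \<theta> \<Gamma>)" "g \<in> residues (lclm \<theta> \<Gamma>)"
  shows "CARD('a) ^ skew_poly_dist \<theta> \<Gamma> (crt_map \<theta> \<Gamma> f) (crt_map \<theta> \<Gamma> g)
    = card (cyclic_submodule (lclm \<theta> \<Gamma>) (f - g))"
proof -
  have "f - g \<in> residues (lclm \<theta> \<Gamma>)"
    using assms by (simp add: residues_eq_polys_below polys_below_diff)
  \<comment> \<open>Since f - g is again reduced, it is the preimage chosen for the difference
    tuple, and \<open>inv_into\<close> disappears from the rest of the argument.\<close>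
  then have "inv_into (residues (lclm \<theta> \<Gamma>)) (crt_map \<theta> \<Gamma>) (crt_map \<theta> \<Gamma> (f - g)) = f - g"
    using inj_on_crt_map by simp
  then show ?thesis
    by (simp add: skew_poly_dist_def skew_poly_weight_def Let_def card_cyclic_submodule[OF lclm_nonzero]
        flip: crt_map_diff)
qed

theorem distance_on_residue_tuples:
  assumes "P_independent \<theta> \<Gamma>"
  shows "distance_on (residue_tuples \<Gamma>) (skew_poly_dist \<theta> \<Gamma>)"
proof -
  let ?P = "lclm \<theta> \<Gamma>" and ?q = "CARD('a)"
  let ?d = "\<lambda>f g. skew_poly_dist \<theta> \<Gamma> (crt_map \<theta> \<Gamma> f) (crt_map \<theta> \<Gamma> g)"
  let ?M = "cyclic_submodule ?P"
  \<comment> \<open>By surjectivity the axioms need checking only on tuples of reduced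
    polynomials.\<close>
  have tuples: "residue_tuples \<Gamma> = crt_map \<theta> \<Gamma> ` residues ?P"
    using skew_chinese_remainder[OF assms] by (simp add: bij_betw_def)
  note d = skew_poly_dist_crt_map
  have zero: "?d f g = 0 \<longleftrightarrow> crt_map \<theta> \<Gamma> f = crt_map \<theta> \<Gamma> g"
    if fg: "f \<in> residues ?P" "g \<in> residues ?P" for f g
  proof -
    have diff: "f - g \<in> residues ?P"
      using fg by (simp add: residues_eq_polys_below polys_below_diff)
    have "mod_r \<theta> 0 ?P = 0"
      using lclm_nonzero mod_r_diff[of ?P 0 0] by simp
    \<comment> \<open>With 0 as a member, having one element means being {0}.\<close>
    then have "0 \<in> ?M (f - g)" unfolding cyclic_submodule_def by (metis rangeI skew_mult_0_left)
    then have "card (?M (f - g)) = 1 \<longleftrightarrow> ?M (f - g) = {0}"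
      by (auto simp: card_1_singleton_iff)
    moreover have "?d f g = 0 \<longleftrightarrow> ?q ^ ?d f g = 1" using CARD_gt_1 by auto
    ultimately have "?d f g = 0 \<longleftrightarrow> f = g"
      using d[OF fg] cyclic_submodule_eq_singleton_iff[OF lclm_nonzero diff] by simp
    then show ?thesis using fg inj_on_crt_map by (auto dest: inj_onD)
  qed
  have sym: "?d f g = ?d g f" if fg: "f \<in> residues ?P" "g \<in> residues ?P" for f g
  proof -
    have "?q ^ ?d f g = ?q ^ ?d g f"
      \<comment> \<open>Here g - f is the negative of f - g, so both generate the same
        submodule.\<close>
      using d fg cyclic_submodule_uminus[of ?P "f - g"] by simp
    then show ?thesis using CARD_gt_1 by (simp add: power_inject_exp)
  qed
  have triangle: "?d f g \<le> ?d f h + ?d h g"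
    if fgh: "f \<in> residues ?P" "g \<in> residues ?P" "h \<in> residues ?P" for f g h
  proof -
    have fin: "finite (?M (f - h) \<times> ?M (g - h))"
      using finite_cyclic_submodule[OF lclm_nonzero] by simp
    \<comment> \<open>Uses f - g = (f - h) - (g - h). The second term is thus the distance from g to
      h, turned around by symmetry at the end.\<close>
    have "?M (f - g) \<subseteq> (\<lambda>(x, y). x - y) ` (?M (f - h) \<times> ?M (g - h))"
      using cyclic_submodule_diff_subset[OF lclm_nonzero, of "f - h" "g - h"] by simp
    then have "card (?M (f - g)) \<le> card (?M (f - h) \<times> ?M (g - h))"
      using surj_card_le[OF fin] by blast
    then have "?q ^ ?d f g \<le> ?q ^ (?d f h + ?d g h)"
      using fgh by (simp add: d power_add card_cartesian_product)
    then show ?thesis using CARD_gt_1 sym[OF fgh(2,3)] by (simp add: power_increasing_iff)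
  qed
  show ?thesis
    unfolding distance_on_def tuples by (auto simp: zero triangle intro: sym)
qed

end

end

theorem proposition4:
  fixes \<theta> :: "'a::{field, finite} \<Rightarrow> 'a"
    and \<Gamma> :: "'a poly list"
  assumes "field_automorphism \<theta>"
    and "\<forall>Q\<in>set \<Gamma>. lead_coeff Q = 1"
    and "P_independent \<theta> \<Gamma>"
  shows "distance_on (residue_tuples \<Gamma>) (skew_poly_dist \<theta> \<Gamma>)"
proof -
  interpret finite_skew_polynomials \<theta> by unfold_locales (rule assms(1))
  show ?thesis using assms(2,3) by (rule distance_on_residue_tuples)
qed

end
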